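(* Let $n\ge 0$, let $X\subseteq\{0,1\}^n$ be nonempty, and let $G=Q_n(X)$ be the daisy cube generated by $X$. Then, as polynomials in $x,y$, $$D_{G,0^n}(x,y)=C_G(x+y-1),$$ where $D_{G,0^n}$ is the distance cube polynomial of $G$ with respect to the vertex $0^n$ and $C_G$ is the cube polynomial of $G$.
   Context: The $n$-cube $Q_n$ is the graph with vertex set $\{0,1\}^n$, two words being adjacent if they differ in exactly one coordinate ($Q_0=K_1$). $0^n$ is the all-zero word. For $u,v\in\{0,1\}^n$ write $u\le v$ if $u_i\le v_i$ for all $i$. For $X\subseteq\{0,1\}^n$, the daisy cube $Q_n(X)$ generated by $X$ is the subgraph of $Q_n$ induced by $\{u\in\{0,1\}^n : u\le x \text{ for some } x\in X\}$. For a finite graph $G$, $c_k(G)$ ($k\ge0$) is the number of induced subgraphs of $G$ isomorphic to $Q_k$, and the cube polynomial is $C_G(x)=\sum_{k\ge 0}c_k(G)x^k$. For $u\in V(G)$ and a subgraph $H$ of $G$, $d(u,H)=\min_{v\in V(H)}d_G(u,v)$. Let $c_{k,d}(G)$ ($k,d\ge 0$) be the number of induced subgraphs $H$ of $G$ isomorphic to $Q_k$ with $d(u,H)=d$. The distance cube polynomial of $G$ with respect to $u$ is $D_{G,u}(x,y)=\sum_{k,d\ge0}c_{k,d}(G)x^ky^d$. *)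

theory Defs
  imports
    "Graph_Theory.Pair_Digraph"
    "Graph_Theory.Digraph_Isomorphism"
    "Graph_Theory.Shortest_Path"
    "HOL-Computational_Algebra.Polynomial"
    "HOL-Library.Groups_Big_Fun"
begin

text \<open>
  An undirected graph is represented as a symmetric digraph: an edge \<open>uv\<close> is the pair of
  arcs \<open>(u, v)\<close> and \<open>(v, u)\<close>. Induced subgraphs, isomorphism and distance are the
  digraph notions, which agree with the undirected ones on symmetric loopfree digraphs without
  multiple arcs.
\<close>

text \<open>
  A word over \<open>{0, 1}\<close> is a list of booleans with \<open>True\<close> for 1; since
  \<open>False \<le> True\<close>, the componentwise order is \<^term>\<open>list_all2 (\<le>)\<close>.
\<close>

definition words :: "nat \<Rightarrow> bool list set" where
  "words n = {w. length w = n}"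

definition hypercube :: "nat \<Rightarrow> (bool list, bool list \<times> bool list) pre_digraph" where
  "hypercube n = with_proj
     \<lparr> pverts = words n,
       parcs = {(u, v). u \<in> words n \<and> v \<in> words n \<and> card {i. i < n \<and> u ! i \<noteq> v ! i} = 1} \<rparr>"

definition daisy_cube ::
    "nat \<Rightarrow> bool list set \<Rightarrow> (bool list, bool list \<times> bool list) pre_digraph" where
  "daisy_cube n X = hypercube n \<restriction> {u \<in> words n. \<exists>x\<in>X. list_all2 (\<le>) u x}"

text \<open>
  Induced subgraphs are counted as digraphs. The relation \<^const>\<open>induced_subgraph\<close>
  forces \<open>H\<close> to have the same head and tail functions as \<open>G\<close>, so that there is exactly
  one \<open>H\<close> for each vertex set.
\<close>

definition induced_cubes :: "('a, 'b) pre_digraph \<Rightarrow> nat \<Rightarrow> ('a, 'b) pre_digraph set" where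
  "induced_cubes G k = {H. induced_subgraph H G \<and> digraph_iso H (hypercube k)}"

definition cube_count :: "('a, 'b) pre_digraph \<Rightarrow> nat \<Rightarrow> nat" where
  "cube_count G k = card (induced_cubes G k)"

definition graph_dist :: "('a, 'b) pre_digraph \<Rightarrow> 'a \<Rightarrow> 'a \<Rightarrow> ereal" where
  "graph_dist G u v = wf_digraph.\<mu> G (\<lambda>_. 1) u v"

definition subgraph_dist :: "('a, 'b) pre_digraph \<Rightarrow> 'a \<Rightarrow> ('a, 'b) pre_digraph \<Rightarrow> ereal" where
  "subgraph_dist G u H = Min (graph_dist G u ` verts H)"

definition dist_cube_count :: "('a, 'b) pre_digraph \<Rightarrow> 'a \<Rightarrow> nat \<Rightarrow> nat \<Rightarrow> nat" where
  "dist_cube_count G u k d = card {H \<in> induced_cubes G k. subgraph_dist G u H = ereal (real d)}"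

text \<open>
  \<^const>\<open>Sum_any\<close> sums over all indices with a nonzero term; for a finite graph these are
  finitely many.
\<close>

definition cube_poly :: "('a, 'b) pre_digraph \<Rightarrow> int poly" where
  "cube_poly G = Sum_any (\<lambda>k. monom (int (cube_count G k)) k)"

text \<open>
  The ring of integer polynomials in \<open>x\<close> and \<open>y\<close> is \<^typ>\<open>int poly poly\<close>, where
  \<open>x\<close> is the outer and \<open>y\<close> the inner variable.
\<close>

definition var_x :: "int poly poly" where
  "var_x = [:0, 1:]"

definition var_y :: "int poly poly" where
  "var_y = [:[:0, 1:]:]"

definition dist_cube_poly :: "('a, 'b) pre_digraph \<Rightarrow> 'a \<Rightarrow> int poly poly" where
  "dist_cube_poly G u =
     Sum_any (\<lambda>(k, d). of_nat (dist_cube_count G u k d) * var_x ^ k * var_y ^ d)"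

text \<open>
  Substitution of a bivariate polynomial into a univariate one; \<^term>\<open>map_poly of_int\<close>
  regards the integer coefficients as constant bivariate polynomials.
\<close>

definition subst_poly :: "int poly \<Rightarrow> int poly poly \<Rightarrow> int poly poly" where
  "subst_poly p q = poly (map_poly of_int p) q"

end

theory Submission
  imports Defs
begin

text \<open>
  Identify a word with its support. An induced subgraph of a daisy cube \<open>G\<close> isomorphic to
  \<open>Q\<^sub>k\<close> is an interval \<open>{b..t}\<close> of sets with \<open>t\<close> a vertex of \<open>G\<close> and
  \<open>card (t - b) = k\<close>, and since \<open>G\<close> is closed downwards, every \<open>b \<subseteq> t\<close> occurs and the
  distance of the interval from the zero word is \<open>card b\<close>. Summing over \<open>b\<close> first, the
  binomial theorem shows that the cubes with top vertex \<open>t\<close> contribute \<open>(x + y)\<close> to the power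
  \<open>card t\<close> to the distance cube polynomial, and \<open>((x + y - 1) + 1)\<close> to the same power to
  \<open>C\<^sub>G(x + y - 1)\<close>.
\<close>

section \<open>Words and their supports\<close>

definition supp :: "bool list \<Rightarrow> nat set" where
  "supp w = {i. i < length w \<and> w ! i}"

text \<open>Inverse of \<open>supp\<close> on subsets of \<open>{..<n}\<close>; a set does not
  record the length of its word, so \<open>n\<close> is an argument.\<close>

definition word :: "nat \<Rightarrow> nat set \<Rightarrow> bool list" where
  "word n S = map (\<lambda>i. i \<in> S) [0..<n]"

lemma word_in_words [simp]: "word n S \<in> words n"
  by (simp add: word_def words_def)

lemma supp_word [simp]: "S \<subseteq> {..<n} \<Longrightarrow> supp (word n S) = S"
  by (auto simp: word_def supp_def)

lemma word_supp [simp]: "w \<in> words n \<Longrightarrow> word n (supp w) = w"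
  by (auto simp: word_def supp_def words_def intro!: nth_equalityI)

lemma supp_subset: "w \<in> words n \<Longrightarrow> supp w \<subseteq> {..<n}"
  by (auto simp: supp_def words_def)

lemma bij_betw_word: "bij_betw (word n) (Pow {..<n}) (words n)"
  by (rule bij_betw_byWitness[where f' = supp]) (auto simp: supp_subset dest: subsetD[OF supp_subset])

lemma supp_replicate_False [simp]: "supp (replicate n False) = {}"
  by (auto simp: supp_def)

lemma list_all2_le_iff_supp:
  assumes "u \<in> words n" "v \<in> words n"
  shows "list_all2 (\<le>) u v \<longleftrightarrow> supp u \<subseteq> supp v"
  using assms by (auto simp: list_all2_conv_all_nth words_def supp_def)

section \<open>Hypercubes, induced subgraphs and embeddings of cubes\<close>

lemma verts_hypercube [simp]: "verts (hypercube n) = words n"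
  by (simp add: hypercube_def)

lemma arcs_hypercube:
  "arcs (hypercube n)
    = {(u, v). u \<in> words n \<and> v \<in> words n \<and> card (sym_diff (supp u) (supp v)) = 1}"
proof -
  have "{i. i < n \<and> u ! i \<noteq> v ! i} = sym_diff (supp u) (supp v)"
    if "u \<in> words n" "v \<in> words n" for u v
    using that by (auto simp: words_def supp_def)
  then show ?thesis
    by (auto simp: hypercube_def)
qed

lemma tail_hypercube [simp]: "tail (hypercube n) = fst"
  and head_hypercube [simp]: "head (hypercube n) = snd"
  by (simp_all add: hypercube_def)

text \<open>Compatibility fixes the head and tail functions and inducedness fixes the arcs, so only
  the vertex set remains free. Counting induced subgraphs thus becomes counting vertex sets.\<close>

lemma induced_subgraph_iff:
  assumes "wf_digraph G"
  shows "induced_subgraph H G \<longleftrightarrow> (\<exists>W \<subseteq> verts G. H = G \<restriction> W)"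
proof
  assume "induced_subgraph H G"
  then have "verts H \<subseteq> verts G" "H = G \<restriction> verts H"
    by (auto simp: induced_subgraph_def subgraph_def compatible_def induce_subgraph_def)
  then show "\<exists>W \<subseteq> verts G. H = G \<restriction> W" by blast
next
  assume "\<exists>W \<subseteq> verts G. H = G \<restriction> W"
  then show "induced_subgraph H G"
    using wf_digraph.induced_induce[OF assms] by blast
qed

text \<open>
  In a 4-cycle of a cube opposite edges flip the same coordinate, so an adjacency-preserving
  injection of one cube into another is a translation composed with a relabelling of coordinates.
\<close>

lemma cube_embedding:
  fixes f :: "'a set \<Rightarrow> 'b set"
  assumes fin: "finite K" and inj: "inj_on f (Pow K)"
    and adj: "\<And>A i. A \<subseteq> K \<Longrightarrow> i \<in> K \<Longrightarrow> i \<notin> A \<Longrightarrow> card (sym_diff (f A) (f (insert i A))) = 1"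
  shows "\<exists>\<delta>. inj_on \<delta> K \<and> (\<forall>A \<subseteq> K. f A = sym_diff (f {}) (\<delta> ` A))"
proof -
  \<comment> \<open>Symmetric difference is read pointwise as exclusive or, so that later steps are
    propositional.\<close>
  have step: "\<exists>j. \<forall>x. x \<in> f (insert i A) \<longleftrightarrow> (x \<in> f A) \<noteq> (x = j)"
    if "A \<subseteq> K" "i \<in> K" "i \<notin> A" for A i
  proof -
    have "card (sym_diff (f A) (f (insert i A))) = 1"
      using adj[of A i] that by simp
    then obtain j where "sym_diff (f A) (f (insert i A)) = {j}"
      by (auto simp: card_1_singleton_iff)
    then have "\<forall>x. x \<in> f (insert i A) \<longleftrightarrow> (x \<in> f A) \<noteq> (x = j)" by blast
    then show ?thesis ..
  qed
  \<comment> \<open>The coordinate flipped by the edge from \<open>f {}\<close> to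
    \<open>f {i}\<close>; \<open>step\<close> guarantees that it exists.\<close>
  define \<delta> where "\<delta> i = (SOME j. \<forall>x. x \<in> f {i} \<longleftrightarrow> (x \<in> f {}) \<noteq> (x = j))" for i
  have \<delta>: "x \<in> f {i} \<longleftrightarrow> (x \<in> f {}) \<noteq> (x = \<delta> i)" if "i \<in> K" for i x
  proof -
    have "\<exists>j. \<forall>x. x \<in> f {i} \<longleftrightarrow> (x \<in> f {}) \<noteq> (x = j)"
      using step[of "{}" i] that by simp
    from someI_ex[OF this] show ?thesis unfolding \<delta>_def by (rule spec)
  qed
  have inj\<delta>: "inj_on \<delta> K"
  proof (rule inj_onI)
    fix i j assume ij: "i \<in> K" "j \<in> K" "\<delta> i = \<delta> j"
    then have "f {i} = f {j}" using \<delta>[of i] \<delta>[of j] by (intro set_eqI) simp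
    then have "{i} = {j}" using inj_onD[OF inj, of "{i}" "{j}"] ij by simp
    then show "i = j" by simp
  qed
  \<comment> \<open>Induction over all proper subsets, since the step for \<open>A\<close> looks
    back at sets with one and with two elements fewer.\<close>
  have main: "A \<subseteq> K \<longrightarrow> (\<forall>x. x \<in> f A \<longleftrightarrow> (x \<in> f {}) \<noteq> (x \<in> \<delta> ` A))" if "finite A" for A
    using that
  proof (induction A rule: finite_psubset_induct)
    case (psubset A)
    show ?case
    proof (intro impI)
      assume AK: "A \<subseteq> K"
      consider "A = {}" | i where "A = {i}" | i j where "i \<in> A" "j \<in> A" "i \<noteq> j"
        by blast
      then show "\<forall>x. x \<in> f A \<longleftrightarrow> (x \<in> f {}) \<noteq> (x \<in> \<delta> ` A)"
      proof cases
        case 1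
        then show ?thesis by simp
      next
        case (2 i)
        then show ?thesis using \<delta>[of i] AK by simp
      next
        case (3 i j)
        \<comment> \<open>\<open>B\<close>, \<open>insert i B\<close>, \<open>A\<close>,
          \<open>insert j B\<close> form the 4-cycle; the induction hypothesis covers every corner
          except \<open>A\<close>.\<close>
        define B where "B = A - {i, j}"
        have K: "B \<subseteq> K" "i \<in> K" "j \<in> K" "i \<notin> B" "j \<notin> B"
          using AK 3 by (auto simp: B_def)
        have A: "A = insert j (insert i B)" "A = insert i (insert j B)"
          using 3 by (auto simp: B_def)
        have "B \<subset> A" "insert i B \<subset> A" "insert j B \<subset> A"
          using 3 by (auto simp: B_def)
        then have IH: "\<forall>x. x \<in> f B \<longleftrightarrow> (x \<in> f {}) \<noteq> (x \<in> \<delta> ` B)"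
            "\<forall>x. x \<in> f (insert i B) \<longleftrightarrow> (x \<in> f {}) \<noteq> (x \<in> \<delta> ` insert i B)"
            "\<forall>x. x \<in> f (insert j B) \<longleftrightarrow> (x \<in> f {}) \<noteq> (x \<in> \<delta> ` insert j B)"
          using psubset.IH[of B] psubset.IH[of "insert i B"] psubset.IH[of "insert j B"] K
          by (simp_all del: image_insert)
        have notin: "\<delta> i \<notin> \<delta> ` B" "\<delta> j \<notin> \<delta> ` B" "\<delta> i \<noteq> \<delta> j"
          using inj_on_image_mem_iff[OF inj\<delta>] inj_on_eq_iff[OF inj\<delta>] K 3 by auto
        have i: "x \<in> f (insert i B) \<longleftrightarrow> (x \<in> f B) \<noteq> (x = \<delta> i)" for x
          using IH(1)[rule_format, of x] IH(2)[rule_format, of x] notin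
          by (cases "x = \<delta> i") simp_all
        have j: "x \<in> f (insert j B) \<longleftrightarrow> (x \<in> f B) \<noteq> (x = \<delta> j)" for x
          using IH(1)[rule_format, of x] IH(3)[rule_format, of x] notin
          by (cases "x = \<delta> j") simp_all
        obtain a where a: "x \<in> f A \<longleftrightarrow> (x \<in> f (insert i B)) \<noteq> (x = a)" for x
          using step[of "insert i B" j] K 3 unfolding A(1) by auto
        obtain b where b: "x \<in> f A \<longleftrightarrow> (x \<in> f (insert j B)) \<noteq> (x = b)" for x
          using step[of "insert j B" i] K 3 unfolding A(2) by auto
        \<comment> \<open>Otherwise the second edge would undo the flip made by the first, giving
          \<open>f A = f B\<close> against injectivity.\<close>
        have "a \<noteq> \<delta> i"
        proof
          assume "a = \<delta> i"
          then have "x \<in> f A \<longleftrightarrow> x \<in> f B" for x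
            using a[of x] i[of x] by (cases "x = \<delta> i") simp_all
          then have "f A = f B" by (intro set_eqI)
          then have "A = B" using inj_onD[OF inj, of A B] AK K by simp
          then show False using 3 by (auto simp: B_def)
        qed
        \<comment> \<open>On the route through \<open>insert i B\<close> the coordinate
          \<open>\<delta> i\<close> is flipped exactly once; on the route through
          \<open>insert j B\<close> only the flip \<open>b\<close> can account for this.\<close>
        then have "b = \<delta> i"
          using a[of "\<delta> i"] b[of "\<delta> i"] i[of "\<delta> i"] j[of "\<delta> i"] notin
          by (cases "\<delta> i = b") simp_all
        then have "x \<in> f A \<longleftrightarrow> ((x \<in> f B) \<noteq> (x = \<delta> i)) \<noteq> (x = \<delta> j)" for x
          using b[of x] j[of x] by (cases "x = \<delta> i"; cases "x = \<delta> j") simp_all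
        then have "x \<in> f A \<longleftrightarrow> (x \<in> f {}) \<noteq> (x \<in> \<delta> ` A)" for x
          using IH(1)[rule_format, of x] notin unfolding A(1) image_insert insert_iff
          by (cases "x = \<delta> i"; cases "x = \<delta> j") simp_all
        then show ?thesis ..
      qed
    qed
  qed
  have "f A = sym_diff (f {}) (\<delta> ` A)" if "A \<subseteq> K" for A
  proof -
    have "\<forall>x. x \<in> f A \<longleftrightarrow> (x \<in> f {}) \<noteq> (x \<in> \<delta> ` A)"
      using main[of A] that finite_subset[OF that fin] by simp
    then show ?thesis by (intro set_eqI) (simp, argo)
  qed
  with inj\<delta> show ?thesis by (intro exI[of _ \<delta>] conjI allI impI)
qed

lemma cube_embedding_image:
  fixes f :: "'a set \<Rightarrow> 'b set"
  assumes "finite K" and "inj_on f (Pow K)"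
    and "\<And>A i. A \<subseteq> K \<Longrightarrow> i \<in> K \<Longrightarrow> i \<notin> A \<Longrightarrow> card (sym_diff (f A) (f (insert i A))) = 1"
  obtains b t where "b \<subseteq> t" "card (t - b) = card K" "f ` Pow K = {b..t}"
proof -
  have "\<exists>\<delta>. inj_on \<delta> K \<and> (\<forall>A \<subseteq> K. f A = sym_diff (f {}) (\<delta> ` A))"
    using assms by (rule cube_embedding)
  then obtain \<delta> where \<delta>: "inj_on \<delta> K" and f: "\<forall>A \<subseteq> K. f A = sym_diff (f {}) (\<delta> ` A)"
    by (elim exE conjE)
  define b t where "b = f {} - \<delta> ` K" and "t = f {} \<union> \<delta> ` K"
  have "f ` Pow K = (\<lambda>A. sym_diff (f {}) (\<delta> ` A)) ` Pow K"
    by (intro image_cong refl f[rule_format] PowD)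
  also have "\<dots> = sym_diff (f {}) ` Pow (\<delta> ` K)"
    unfolding image_Pow_surj[OF refl, symmetric] image_image ..
  also have "\<dots> = {b..t}"
  proof (intro equalityI subsetI)
    fix S assume "S \<in> {b..t}"
    \<comment> \<open>Symmetric difference with \<open>f {}\<close> is an involution, which supplies
      the preimage of \<open>S\<close>.\<close>
    then have "S = sym_diff (f {}) (sym_diff (f {}) S)" "sym_diff (f {}) S \<in> Pow (\<delta> ` K)"
      by (auto simp: b_def t_def)
    then show "S \<in> sym_diff (f {}) ` Pow (\<delta> ` K)" by (rule image_eqI)
  qed (auto simp: b_def t_def)
  finally have "f ` Pow K = {b..t}" .
  moreover have "t - b = \<delta> ` K" "b \<subseteq> t" by (auto simp: b_def t_def)
  ultimately show thesis using that[of b t] card_image[OF \<delta>] by simp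
qed

section \<open>Induced cubes of a hypercube are exactly the intervals\<close>

lemma induce_subgraph_induce_subgraph: "W \<subseteq> V \<Longrightarrow> (G \<restriction> V) \<restriction> W = G \<restriction> W"
  by (auto simp: induce_subgraph_def)

lemma inj_on_supp: "inj_on supp (words n)"
  by (metis inj_on_inverseI word_supp)

text \<open>Read on supports, the inverse isomorphism is an injection from the subsets of
  \<open>{..<k}\<close> that sends edges to edges, so \<open>cube_embedding_image\<close> describes
  its image.\<close>

lemma digraph_iso_hypercube_imp_interval:
  assumes W: "W \<subseteq> words n" and iso: "digraph_iso (hypercube n \<restriction> W) (hypercube k)"
  obtains b t where "b \<subseteq> t" "card (t - b) = k" "supp ` W = {b..t}"
proof -
  let ?H = "hypercube n \<restriction> W"
  obtain h where h: "pre_digraph.digraph_isomorphism ?H h" and eq: "hypercube k = app_iso h ?H"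
    using iso by (auto simp: digraph_iso_def)
  define g where "g = the_inv_into W (iso_verts h)"
  have inj: "inj_on (iso_verts h) W"
    using h by (simp add: pre_digraph.digraph_isomorphism_def)
  have img: "iso_verts h ` W = words k"
    using arg_cong[OF eq, of verts] by simp
  have bij: "bij_betw g (words k) W"
    unfolding g_def using inj img by (intro bij_betw_the_inv_into) (simp add: bij_betw_def)
  have arc: "(g u, g v) \<in> arcs (hypercube n)" if uv: "(u, v) \<in> arcs (hypercube k)" for u v
  proof -
    obtain e where e: "e \<in> arcs ?H" "(u, v) = iso_arcs h e"
      using uv unfolding eq by auto
    \<comment> \<open>The isomorphism carries separate maps for vertices and arcs; its compatibility
      with tails and heads identifies the endpoints of the preimage arc \<open>e\<close>.\<close>
    have "iso_verts h (fst e) = iso_tail h (iso_arcs h e)"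
         "iso_verts h (snd e) = iso_head h (iso_arcs h e)"
      using pre_digraph.iso_verts_tail[OF h e(1)] pre_digraph.iso_verts_head[OF h e(1)] by simp_all
    moreover have "iso_tail h = fst" "iso_head h = snd"
      using arg_cong[OF eq, of tail] arg_cong[OF eq, of head] by simp_all
    ultimately have "u = iso_verts h (fst e)" "v = iso_verts h (snd e)"
      by (simp_all flip: e(2))
    then have "g u = fst e" "g v = snd e"
      using e(1) inj by (auto simp: g_def the_inv_into_f_f)
    then show ?thesis using e(1) by simp
  qed
  define f where "f A = supp (g (word k A))" for A
  have f_image: "f ` Pow {..<k} = supp ` W"
  proof -
    have "f ` Pow {..<k} = supp ` g ` word k ` Pow {..<k}"
      by (simp add: f_def image_image)
    then show ?thesis
      using bij bij_betw_word[of k] by (simp add: bij_betw_def)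
  qed
  have "inj_on (supp \<circ> g \<circ> word k) (Pow {..<k})"
    using bij bij_betw_word[of k] inj_on_subset[OF inj_on_supp W]
    by (intro comp_inj_on) (simp_all add: bij_betw_def)
  then have f_inj: "inj_on f (Pow {..<k})"
    by (simp add: f_def[abs_def] comp_def)
  have f_adj: "card (sym_diff (f A) (f (insert i A))) = 1"
    if "A \<subseteq> {..<k}" "i \<in> {..<k}" "i \<notin> A" for A i
  proof -
    have "sym_diff A (insert i A) = {i}" using that by auto
    then have "(word k A, word k (insert i A)) \<in> arcs (hypercube k)"
      using that by (simp add: arcs_hypercube)
    from arc[OF this] show ?thesis
      by (simp add: arcs_hypercube f_def)
  qed
  obtain b t where bt: "b \<subseteq> t" "card (t - b) = card {..<k}" "f ` Pow {..<k} = {b..t}"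
    using finite_lessThan f_inj f_adj by (rule cube_embedding_image)
  then show thesis using that[of b t] f_image by simp
qed

lemma card_sym_diff_image:
  assumes "inj_on h D" "A \<subseteq> D" "B \<subseteq> D"
  shows "card (sym_diff (h ` A) (h ` B)) = card (sym_diff A B)"
proof -
  have "sym_diff (h ` A) (h ` B) = h ` sym_diff A B"
    unfolding image_Un
    using inj_on_image_set_diff[OF assms(1), of A B] inj_on_image_set_diff[OF assms(1), of B A]
      assms(2,3) by (simp add: le_supI1 Diff_subset[THEN order_trans])
  moreover have "inj_on h (sym_diff A B)"
    using assms by (auto intro: inj_on_subset)
  ultimately show ?thesis by (simp add: card_image)
qed

lemma bij_betw_supp_interval:
  assumes "t \<subseteq> {..<n}"
  shows "bij_betw supp {u \<in> words n. supp u \<in> {b..t}} {b..t}"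
proof (rule bij_betw_byWitness[where f' = "word n"])
  have "S \<subseteq> {..<n}" if "S \<in> {b..t}" for S
    using that assms by auto
  then show "\<forall>S \<in> {b..t}. supp (word n S) = S" "word n ` {b..t} \<subseteq> {u \<in> words n. supp u \<in> {b..t}}"
    by (simp_all add: image_subset_iff)
qed auto

text \<open>Removing the common part \<open>b\<close> and relabelling \<open>t - b\<close> by
  \<open>{..<k}\<close> preserves the size of symmetric differences, hence adjacency in both
  directions.\<close>

lemma digraph_iso_interval:
  assumes bt: "b \<subseteq> t" and t: "t \<subseteq> {..<n}" and card: "card (t - b) = k"
  shows "digraph_iso (hypercube n \<restriction> {u \<in> words n. supp u \<in> {b..t}}) (hypercube k)"
proof -
  define W where "W = {u \<in> words n. supp u \<in> {b..t}}"
  have "finite (t - b)"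
    using t finite_subset by blast
  then obtain h where h: "bij_betw h (t - b) {..<k}"
    using card finite_same_card_bij[of "t - b" "{..<k}"] by auto
  define \<phi> where "\<phi> u = word k (h ` (supp u - b))" for u
  have "bij_betw supp W {b..t}"
    unfolding W_def using t by (rule bij_betw_supp_interval)
  moreover have "bij_betw (\<lambda>S. S - b) {b..t} (Pow (t - b))"
    by (rule bij_betw_byWitness[where f' = "\<lambda>S. S \<union> b"]) (use bt in auto)
  moreover have "bij_betw (image h) (Pow (t - b)) (Pow {..<k})"
    using h by (rule bij_betw_Pow)
  ultimately have "bij_betw (word k \<circ> (image h \<circ> ((\<lambda>S. S - b) \<circ> supp))) W (words k)"
    using bij_betw_word by (blast intro: bij_betw_trans)
  then have "bij_betw \<phi> W (words k)"
    by (simp add: \<phi>_def[abs_def] comp_def)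
  then have inj: "inj_on \<phi> W" and img: "\<phi> ` W = words k"
    by (simp_all add: bij_betw_def)
  have supp_\<phi>: "supp (\<phi> u) = h ` (supp u - b)" if "u \<in> W" for u
  proof -
    have "h ` (supp u - b) \<subseteq> {..<k}"
      using h that by (auto simp: bij_betw_def W_def)
    then show ?thesis by (simp add: \<phi>_def)
  qed
  have card_\<phi>: "card (sym_diff (supp (\<phi> u)) (supp (\<phi> v))) = card (sym_diff (supp u) (supp v))"
    if "u \<in> W" "v \<in> W" for u v
  proof -
    have "card (sym_diff (supp (\<phi> u)) (supp (\<phi> v))) = card (sym_diff (supp u - b) (supp v - b))"
      unfolding supp_\<phi>[OF that(1)] supp_\<phi>[OF that(2)]
      by (rule card_sym_diff_image[of h "t - b"]) (use that h in \<open>auto simp: W_def bij_betw_def\<close>)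
    also have "sym_diff (supp u - b) (supp v - b) = sym_diff (supp u) (supp v)"
      using that by (auto simp: W_def)
    finally show ?thesis .
  qed
  \<comment> \<open>Arcs are pairs of vertices, so the vertex map \<open>\<phi>\<close> dictates the
    arc map.\<close>
  let ?iso = "\<lparr>iso_verts = \<phi>, iso_arcs = map_prod \<phi> \<phi>, iso_head = snd, iso_tail = fst\<rparr>"
  let ?H = "hypercube n \<restriction> W"
  have "wf_digraph ?H"
    by unfold_locales auto
  moreover have "arcs ?H \<subseteq> W \<times> W"
    by auto
  then have "inj_on (map_prod \<phi> \<phi>) (arcs ?H)"
    using map_prod_inj_on[OF inj inj] inj_on_subset by blast
  ultimately have "pre_digraph.digraph_isomorphism ?H ?iso"
    using inj by (simp add: pre_digraph.digraph_isomorphism_def)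
  moreover have "map_prod \<phi> \<phi> ` arcs ?H = arcs (hypercube k)"
  proof -
    have "W \<subseteq> words n" by (auto simp: W_def)
    then have H: "arcs ?H = {(u, v). u \<in> W \<and> v \<in> W \<and> card (sym_diff (supp u) (supp v)) = 1}"
      by (auto simp: arcs_hypercube)
    show ?thesis
      unfolding H arcs_hypercube img[symmetric] by (auto simp: card_\<phi>)
  qed
  then have "hypercube k = app_iso ?iso ?H"
    by (intro pre_digraph.equality) (simp_all add: img)
  ultimately show ?thesis
    unfolding W_def[symmetric] digraph_iso_def by blast
qed

text \<open>Along an edge this bounds the growth of the support by one, which yields the lower bound
  on distances.\<close>

lemma card_le_add_card_sym_diff:
  assumes "finite A" "finite B"
  shows "card B \<le> card A + card (sym_diff A B)"
proof -
  have "card B \<le> card (A \<union> sym_diff A B)"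
    using assms by (intro card_mono) auto
  also have "\<dots> \<le> card A + card (sym_diff A B)"
    by (rule card_Un_le)
  finally show ?thesis .
qed

lemma finite_supp [simp]: "finite (supp w)"
  by (simp add: supp_def)

section \<open>Sums behind the two polynomials\<close>

text \<open>Grouping \<open>P\<close> by the value of \<open>a\<close> turns a generating function
  with counted coefficients into a finite sum with one term per object. The index may be an exponent
  or a pair of exponents.\<close>

lemma Sum_any_card_fibres:
  fixes h :: "'b \<Rightarrow> 'c :: comm_semiring_1"
  assumes "finite P"
  shows "Sum_any (\<lambda>k. of_nat (card {p \<in> P. a p = k}) * h k) = (\<Sum>p\<in>P. h (a p))"
proof -
  have "Sum_any (\<lambda>k. of_nat (card {p \<in> P. a p = k}) * h k)
      = (\<Sum>k\<in>a ` P. of_nat (card {p \<in> P. a p = k}) * h k)"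
  proof (rule Sum_any.expand_superset)
    show "{k. of_nat (card {p \<in> P. a p = k}) * h k \<noteq> 0} \<subseteq> a ` P"
    proof (clarify, rule ccontr)
      fix k assume "of_nat (card {p \<in> P. a p = k}) * h k \<noteq> 0" "k \<notin> a ` P"
      moreover from this(2) have "{p \<in> P. a p = k} = {}" by blast
      ultimately show False by simp
    qed
  qed (use assms in simp)
  also have "\<dots> = (\<Sum>k\<in>a ` P. \<Sum>p | p \<in> P \<and> a p = k. h (a p))"
    by (intro sum.cong) auto
  also have "\<dots> = (\<Sum>p\<in>P. h (a p))"
    using assms by (rule sum.image_gen[symmetric])
  finally show ?thesis .
qed

text \<open>Expanding the product of \<open>y + x\<close> over \<open>t\<close>, each
  \<open>b\<close> records the factors from which \<open>y\<close> is chosen.\<close>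

lemma sum_Pow_power_card:
  fixes x y :: "'c :: comm_semiring_1"
  assumes "finite t"
  shows "(\<Sum>b\<in>Pow t. x ^ card (t - b) * y ^ card b) = (x + y) ^ card t"
  using prod_add[OF assms, of "\<lambda>_. y" "\<lambda>_. x"] by (simp add: ac_simps)

text \<open>Substitution is additive and sends \<open>monom 1 k\<close> to
  \<open>q ^ k\<close>.\<close>

lemma subst_poly_sum_monom:
  "subst_poly (\<Sum>p\<in>P. monom 1 (a p)) q = (\<Sum>p\<in>P. q ^ a p)"
proof -
  have add: "subst_poly (p + r) q = subst_poly p q + subst_poly r q" for p r
  proof -
    have "map_poly of_int (p + r) = map_poly of_int p + (map_poly of_int r :: int poly poly poly)"
      by (rule poly_eqI) (simp add: coeff_map_poly)
    then show ?thesis by (simp add: subst_poly_def)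
  qed
  have monom: "subst_poly (monom 1 k) q = q ^ k" for k
    by (simp add: subst_poly_def map_poly_monom poly_monom)
  have zero: "subst_poly 0 q = 0"
    by (simp add: subst_poly_def)
  show ?thesis
    by (induction P rule: infinite_finite_induct) (simp_all add: add monom zero)
qed

section \<open>Daisy cubes as down-closed families of supports\<close>

locale down_closed_family =
  fixes n :: nat and F :: "nat set set"
  assumes F_subset: "S \<in> F \<Longrightarrow> S \<subseteq> {..<n}"
    and F_down: "t \<in> F \<Longrightarrow> b \<subseteq> t \<Longrightarrow> b \<in> F"
begin

definition G :: "(bool list, bool list \<times> bool list) pre_digraph" where
  "G = hypercube n \<restriction> {u \<in> words n. supp u \<in> F}"

definition subcube :: "nat set \<Rightarrow> nat set \<Rightarrow> (bool list, bool list \<times> bool list) pre_digraph" where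
  "subcube b t = G \<restriction> {u \<in> words n. supp u \<in> {b..t}}"

text \<open>The index set for all induced cubes. Membership of \<open>t\<close> in \<open>F\<close>
  suffices, as \<open>F_down\<close> then puts the whole interval into \<open>F\<close>.\<close>

definition intervals :: "(nat set \<times> nat set) set" where
  "intervals = {(b, t). b \<subseteq> t \<and> t \<in> F}"

lemma verts_G [simp]: "verts G = {u \<in> words n. supp u \<in> F}"
  by (simp add: G_def)

lemma arcs_G:
  "arcs G = {(u, v). u \<in> verts G \<and> v \<in> verts G \<and> card (sym_diff (supp u) (supp v)) = 1}"
  by (auto simp: G_def arcs_hypercube)

lemma tail_G [simp]: "tail G = fst" and head_G [simp]: "head G = snd"
  by (simp_all add: G_def)

text \<open>Makes walks and the distance \<open>\<mu>\<close> of \<open>G\<close> available without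
  qualification.\<close>

sublocale wf_digraph G
  by unfold_locales (auto simp: arcs_G)

lemma supp_word_F [simp]: "S \<in> F \<Longrightarrow> supp (word n S) = S"
  by (simp add: F_subset)

lemma finite_mem_F: "S \<in> F \<Longrightarrow> finite S"
  using F_subset finite_subset by blast

lemma finite_F: "finite F"
  by (rule finite_subset[of _ "Pow {..<n}"]) (use F_subset in auto)

text \<open>With the top first this is a dependent sum: for fixed \<open>t\<close> the bottom ranges
  freely over \<open>Pow t\<close>.\<close>

lemma intervals_eq: "intervals = (\<lambda>(t, b). (b, t)) ` (SIGMA t:F. Pow t)"
  by (auto simp: intervals_def image_iff)

lemma finite_intervals: "finite intervals"
  unfolding intervals_eq
  using finite_F finite_mem_F by (intro finite_imageI finite_SigmaI) auto

lemma verts_subcube [simp]: "verts (subcube b t) = {u \<in> words n. supp u \<in> {b..t}}"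
  by (simp add: subcube_def)

lemma supp_verts_subcube:
  assumes "(b, t) \<in> intervals"
  shows "supp ` verts (subcube b t) = {b..t}"
  using bij_betw_supp_interval[of t n b] assms F_subset[of t]
  by (simp add: intervals_def bij_betw_def)

text \<open>The vertices determine the set \<open>{b..t}\<close>, and a nonempty interval determines
  its endpoints.\<close>

lemma inj_on_subcube: "inj_on (\<lambda>(b, t). subcube b t) intervals"
proof (rule inj_onI, clarify)
  fix b t b' t'
  assume *: "(b, t) \<in> intervals" "(b', t') \<in> intervals" "subcube b t = subcube b' t'"
  then have "{b..t} = {b'..t'}"
    using supp_verts_subcube by metis
  then show "b = b' \<and> t = t'"
    using * by (auto simp: intervals_def)
qed

lemma induced_cubes_G:
  "induced_cubes G k = (\<lambda>(b, t). subcube b t) ` {(b, t) \<in> intervals. card (t - b) = k}"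
proof (intro equalityI subsetI)
  fix H assume "H \<in> induced_cubes G k"
  then obtain W where W: "W \<subseteq> verts G" "H = G \<restriction> W" and iso: "digraph_iso H (hypercube k)"
    by (auto simp: induced_cubes_def induced_subgraph_iff[OF wf_digraph])
  have "H = hypercube n \<restriction> W"
    using W by (simp add: G_def induce_subgraph_induce_subgraph)
  moreover have Wn: "W \<subseteq> words n" using W by auto
  ultimately obtain b t where bt: "b \<subseteq> t" "card (t - b) = k" "supp ` W = {b..t}"
    using digraph_iso_hypercube_imp_interval[of W n k] iso by metis
  have "t \<in> supp ` W" using bt by simp
  then have "t \<in> F" using W by auto
  \<comment> \<open>Injectivity of \<open>supp\<close> on words recovers \<open>W\<close> from its
    set of supports.\<close>
  have "W = {u \<in> words n. supp u \<in> {b..t}}"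
    using bt(3) Wn inj_on_image_mem_iff[OF inj_on_supp _ Wn] by blast
  then have "H = subcube b t"
    using W by (simp add: subcube_def)
  then show "H \<in> (\<lambda>(b, t). subcube b t) ` {(b, t) \<in> intervals. card (t - b) = k}"
    using bt \<open>t \<in> F\<close> by (auto simp: intervals_def)
next
  fix H assume "H \<in> (\<lambda>(b, t). subcube b t) ` {(b, t) \<in> intervals. card (t - b) = k}"
  then obtain b t where bt: "b \<subseteq> t" "t \<in> F" "card (t - b) = k" and H: "H = subcube b t"
    by (auto simp: intervals_def)
  \<comment> \<open>By downward closure the interval stays inside \<open>G\<close>, so it induces
    the same subgraph in \<open>G\<close> as in the full hypercube.\<close>
  have sub: "{u \<in> words n. supp u \<in> {b..t}} \<subseteq> {u \<in> words n. supp u \<in> F}"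
    using F_down bt by auto
  then have "H = hypercube n \<restriction> {u \<in> words n. supp u \<in> {b..t}}"
    by (simp add: H subcube_def G_def induce_subgraph_induce_subgraph)
  then have "digraph_iso H (hypercube k)"
    using digraph_iso_interval[of b t n k] bt F_subset[of t] by simp
  moreover have "induced_subgraph H G"
    using sub H by (auto simp: induced_subgraph_iff[OF wf_digraph] subcube_def)
  ultimately show "H \<in> induced_cubes G k"
    by (simp add: induced_cubes_def)
qed

section \<open>Distances from the zero word\<close>

lemma awalk_card_le:
  assumes "awalk u p v"
  shows "card (supp v) \<le> card (supp u) + length p"
  using assms
proof (induction p arbitrary: u)
  case Nil
  then show ?case by (simp add: awalk_Nil_iff)
next
  case (Cons e p)
  then have e: "e \<in> arcs G" "u = fst e" and "awalk (snd e) p v"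
    by (auto simp: awalk_Cons_iff)
  then have "card (supp v) \<le> card (supp (snd e)) + length p"
    using Cons.IH by blast
  moreover have "card (supp (snd e)) \<le> card (supp u) + 1"
    using e card_le_add_card_sym_diff[of "supp u" "supp (snd e)"] by (auto simp: arcs_G)
  ultimately show ?case by simp
qed

text \<open>Elements of \<open>S\<close> are switched on one at a time; every intermediate set is a
  subset of \<open>S\<close> and so lies in \<open>F\<close>.\<close>

lemma awalk_from_word:
  assumes "S \<in> F"
  shows "\<exists>p. awalk (word n {}) p (word n S) \<and> length p = card S"
proof -
  have "finite S" using assms by (rule finite_mem_F)
  then show ?thesis using assms
  proof (induction S rule: finite_induct)
    case empty
    then show ?case by (intro exI[of _ "[]"]) (simp add: awalk_Nil_iff)
  next
    case (insert i S)
    have S: "S \<in> F" using F_down[OF insert.prems] by blast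
    then obtain p where p: "awalk (word n {}) p (word n S)" "length p = card S"
      using insert.IH by blast
    have "sym_diff S (insert i S) = {i}" using insert.hyps by auto
    then have "(word n S, word n (insert i S)) \<in> arcs G"
      using S insert.prems by (simp add: arcs_G)
    then have "awalk (word n S) [(word n S, word n (insert i S))] (word n (insert i S))"
      using insert.prems by (simp add: awalk_Cons_iff awalk_Nil_iff)
    with p(1) have "awalk (word n {}) (p @ [(word n S, word n (insert i S))]) (word n (insert i S))"
      by (rule awalk_appendI)
    moreover have "length (p @ [(word n S, word n (insert i S))]) = card (insert i S)"
      using p(2) insert.hyps by simp
    ultimately show ?case by blast
  qed
qed

lemma awalk_cost_one: "awalk_cost (\<lambda>_. 1) p = length p"
  by (induction p) auto

lemma replicate_False: "replicate n False = word n {}"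
  by (simp add: word_def map_replicate_const)

text \<open>\<open>\<mu>\<close> is an infimum over walks: \<open>awalk_from_word\<close> attains
  the value and \<open>awalk_card_le\<close> bounds it below.\<close>

lemma graph_dist_G:
  assumes "v \<in> verts G"
  shows "graph_dist G (replicate n False) v = ereal (card (supp v))"
proof -
  obtain p where p: "awalk (replicate n False) p v" "length p = card (supp v)"
    using awalk_from_word[of "supp v"] assms by (auto simp: replicate_False)
  have "\<mu> (\<lambda>_. 1) (replicate n False) v = ereal (card (supp v))"
  proof (rule antisym)
    show "\<mu> (\<lambda>_. 1) (replicate n False) v \<le> ereal (card (supp v))"
      using min_cost_le_walk_cost[OF p(1), of "\<lambda>_. 1"] p(2) by (simp add: awalk_cost_one)
    show "ereal (card (supp v)) \<le> \<mu> (\<lambda>_. 1) (replicate n False) v"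
      unfolding \<mu>_def using awalk_card_le[of "replicate n False" _ v]
      by (intro INF_greatest) (simp add: awalk_cost_one)
  qed
  then show ?thesis by (simp add: graph_dist_def)
qed

text \<open>Cardinality is monotone under inclusion, so the minimum over the interval is attained at
  its bottom.\<close>

lemma subgraph_dist_subcube:
  assumes "(b, t) \<in> intervals"
  shows "subgraph_dist G (replicate n False) (subcube b t) = ereal (card b)"
proof -
  have bt: "b \<subseteq> t" "t \<in> F" "finite t"
    using assms finite_mem_F by (auto simp: intervals_def)
  have sub: "verts (subcube b t) \<subseteq> verts G"
    using bt F_down by auto
  have "graph_dist G (replicate n False) ` verts (subcube b t)
      = (\<lambda>u. ereal (card (supp u))) ` verts (subcube b t)"
    using sub graph_dist_G by (intro image_cong) auto
  also have "\<dots> = (\<lambda>S. ereal (card S)) ` {b..t}"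
    unfolding supp_verts_subcube[OF assms, symmetric] by (simp only: image_image)
  finally have eq: "graph_dist G (replicate n False) ` verts (subcube b t)
      = (\<lambda>S. ereal (card S)) ` {b..t}" .
  have fin: "finite {b..t}"
    by (rule finite_subset[of _ "Pow t"]) (use bt in auto)
  show ?thesis
    unfolding subgraph_dist_def eq
  proof (rule Min_eqI)
    fix y assume "y \<in> (\<lambda>S. ereal (card S)) ` {b..t}"
    then show "ereal (card b) \<le> y"
      using card_mono[OF finite_subset[OF _ \<open>finite t\<close>]] by auto
  qed (use bt fin in auto)
qed

section \<open>The two polynomials as sums over intervals\<close>

lemma cube_count_G: "cube_count G k = card {(b, t) \<in> intervals. card (t - b) = k}"
  unfolding cube_count_def induced_cubes_G
  by (intro card_image inj_on_subset[OF inj_on_subcube]) auto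

lemma dist_cube_count_G:
  "dist_cube_count G (replicate n False) k d
    = card {(b, t) \<in> intervals. card (t - b) = k \<and> card b = d}"
proof -
  have "{H \<in> induced_cubes G k. subgraph_dist G (replicate n False) H = ereal (real d)}
      = (\<lambda>(b, t). subcube b t) ` {(b, t) \<in> intervals. card (t - b) = k \<and> card b = d}"
    unfolding induced_cubes_G by (auto simp: subgraph_dist_subcube)
  then show ?thesis
    unfolding dist_cube_count_def
    by (simp only:) (intro card_image inj_on_subset[OF inj_on_subcube], auto)
qed

lemma cube_poly_G: "cube_poly G = (\<Sum>(b, t)\<in>intervals. monom 1 (card (t - b)))"
proof -
  have "monom (int c) k = of_nat c * monom 1 k" for c k
    by (simp add: of_nat_poly smult_monom)
  then show ?thesis
    using Sum_any_card_fibres[OF finite_intervals, of "\<lambda>(b, t). card (t - b)" "monom (1 :: int)"]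
    by (simp add: cube_poly_def cube_count_G case_prod_unfold)
qed

lemma dist_cube_poly_G:
  "dist_cube_poly G (replicate n False)
    = (\<Sum>(b, t)\<in>intervals. var_x ^ card (t - b) * var_y ^ card b)"
  using Sum_any_card_fibres[OF finite_intervals, of "\<lambda>(b, t). (card (t - b), card b)"
      "\<lambda>(k, d). var_x ^ k * var_y ^ d"]
  by (simp add: dist_cube_poly_def dist_cube_count_G case_prod_unfold mult.assoc prod_eq_iff)

text \<open>Summing over the bottoms of each fixed top applies the binomial theorem. General
  \<open>x\<close> and \<open>y\<close> let one identity serve both polynomials.\<close>

lemma sum_intervals:
  fixes x y :: "'c :: comm_semiring_1"
  shows "(\<Sum>(b, t)\<in>intervals. x ^ card (t - b) * y ^ card b) = (\<Sum>t\<in>F. (x + y) ^ card t)"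
proof -
  have "inj_on (\<lambda>(t, b). (b, t)) (SIGMA t:F. Pow t)"
    by (auto simp: inj_on_def)
  then have "(\<Sum>(b, t)\<in>intervals. x ^ card (t - b) * y ^ card b)
      = (\<Sum>(t, b)\<in>(SIGMA t:F. Pow t). x ^ card (t - b) * y ^ card b)"
    unfolding intervals_eq by (subst sum.reindex) (auto simp: case_prod_unfold)
  also have "\<dots> = (\<Sum>t\<in>F. \<Sum>b\<in>Pow t. x ^ card (t - b) * y ^ card b)"
    using finite_F finite_mem_F by (intro sum.Sigma[symmetric]) auto
  also have "\<dots> = (\<Sum>t\<in>F. (x + y) ^ card t)"
    using sum_Pow_power_card finite_mem_F by (intro sum.cong) auto
  finally show ?thesis .
qed

lemma dist_cube_poly_eq_subst:
  "dist_cube_poly G (replicate n False) = subst_poly (cube_poly G) (var_x + var_y - 1)"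
proof -
  have "subst_poly (cube_poly G) (var_x + var_y - 1)
      = (\<Sum>(b, t)\<in>intervals. (var_x + var_y - 1) ^ card (t - b))"
    by (simp add: cube_poly_G subst_poly_sum_monom case_prod_unfold)
  \<comment> \<open>Taking \<open>y = 1\<close> removes the weight of the bottom, and the added 1
    cancels the -1 in the substituted argument.\<close>
  also have "\<dots> = (\<Sum>t\<in>F. (var_x + var_y) ^ card t)"
    using sum_intervals[of "var_x + var_y - 1" 1] by simp
  also have "\<dots> = dist_cube_poly G (replicate n False)"
    by (simp add: dist_cube_poly_G sum_intervals)
  finally show ?thesis by simp
qed

end

theorem theorem3p3:
  fixes n :: nat and X :: "bool list set"
  assumes "X \<subseteq> words n" and "X \<noteq> {}"
  shows "dist_cube_poly (daisy_cube n X) (replicate n False)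
    = subst_poly (cube_poly (daisy_cube n X)) (var_x + var_y - 1)"
proof -
  \<comment> \<open>The supports of the vertices of the daisy cube; this family is closed downwards
    by construction.\<close>
  define F where "F = {S. \<exists>x\<in>X. S \<subseteq> supp x}"
  interpret down_closed_family n F
  proof
    show "S \<subseteq> {..<n}" if "S \<in> F" for S
      using that assms(1) supp_subset unfolding F_def by blast
    show "b \<in> F" if "t \<in> F" "b \<subseteq> t" for b t
      using that unfolding F_def by blast
  qed
  have "{u \<in> words n. \<exists>x\<in>X. list_all2 (\<le>) u x} = {u \<in> words n. supp u \<in> F}"
    using assms(1) list_all2_le_iff_supp unfolding F_def by blast
  then have "daisy_cube n X = G"
    by (simp add: daisy_cube_def G_def)
  then show ?thesis
    by (simp add: dist_cube_poly_eq_subst)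
qed

end
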